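(* Let $X$ be a finite ultrametric space consisting of $n\ge 2$ points, let $\sigma(X)=(\sigma_1,\sigma_2,\ldots,\sigma_{n-1})$ be its $\operatorname{mst}$-spectrum, let $m>0$ be a cardinal number, let $\lambda>0$, and let $\lambda\Delta_m$ be a simplex of cardinality $m$ all of whose non-zero distances equal $\lambda$. Then $$ 2d_{GH}(\lambda\Delta_m,X)= \begin{cases} \sigma_1&\text{for } m=1,\\ \max\{\sigma_1-\lambda,\ \sigma_m,\ \lambda-\sigma_{m-1}\}&\text{for } 1<m<n,\\ \max\{\sigma_1-\lambda,\ \lambda-\sigma_{n-1}\}&\text{for } m=n,\\ \max\{\sigma_1-\lambda,\ \lambda\}&\text{for } m>n. \end{cases} $$
   Context: $|xy|$ denotes the distance between points $x,y$ of a metric space. A metric space $X$ is ultrametric if $|xz|\le\max\{|xy|,|yz|\}$ for all $x,y,z\in X$. A simplex is a metric space all of whose non-zero distances are the same. Gromov--Hausdorff distance: for non-empty subsets $A,B$ of a metric space $Z$, the Hausdorff distance is $d_H(A,B)=\inf\{r>0: A\subset U_r(B),\ B\subset U_r(A)\}$, where $U_r(A)$ is the union of the open balls of radius $r$ centered at the points of $A$. For metric spaces $X,Y$, $d_{GH}(X,Y)$ is the infimum of the real numbers $r$ for which there exist a metric space $Z$ and subsets $X',Y'\subset Z$ isometric to $X$ and $Y$ respectively such that $d_H(X',Y')\le r$. Minimal spanning trees: for a finite metric space $X$ and a tree $G=(X,E)$ with vertex set $X$, the length of an edge $e=vw$ is $|e|=|vw|$ and the length of $G$ is the sum of the lengths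 of its edges. A minimal spanning tree on $X$ is a tree with vertex set $X$ of least possible length. For a minimal spanning tree $G$, $\sigma(G)$ is the vector of edge lengths of $G$ written in decreasing (i.e. non-increasing) order; this vector does not depend on the choice of the minimal spanning tree $G$, and it is denoted by $\sigma(X)$ and called the $\operatorname{mst}$-spectrum of $X$. *)

theory Defs
  imports "HOL-Analysis.Analysis" "HOL-Library.Multiset"
begin

unbundle cardinal_syntax
no_notation elt_set_eq (infix "=o" 50)

section \<open>Ultrametric spaces and simplexes\<close>

definition ultrametric_space :: "'a set \<Rightarrow> ('a \<Rightarrow> 'a \<Rightarrow> real) \<Rightarrow> bool" where
  "ultrametric_space X d \<longleftrightarrow>
     Metric_space X d \<and> (\<forall>x\<in>X. \<forall>y\<in>X. \<forall>z\<in>X. d x z \<le> max (d x y) (d y z))"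

text \<open>Cardinal numbers, finite or infinite, are represented by the relations satisfying
  \<^const>\<open>Card_order\<close>; a natural number \<open>k\<close> is embedded as the cardinal of \<open>{..<k}\<close>.\<close>

definition nat_card :: "nat \<Rightarrow> nat rel" where
  "nat_card k = |{..<k}|"

definition is_simplex :: "real \<Rightarrow> 'c rel \<Rightarrow> 'a set \<Rightarrow> ('a \<Rightarrow> 'a \<Rightarrow> real) \<Rightarrow> bool" where
  "is_simplex lam m S d \<longleftrightarrow>
     Metric_space S d \<and> |S| =o m \<and> (\<forall>x\<in>S. \<forall>y\<in>S. d x y \<noteq> 0 \<longrightarrow> d x y = lam)"

section \<open>Gromov--Hausdorff distance\<close>

text \<open>Both distances take values in \<^typ>\<open>ereal\<close>, so that the infimum of the empty set is
  \<open>\<infinity>\<close> rather than an unspecified real number.\<close>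

definition nbhd :: "'a set \<Rightarrow> ('a \<Rightarrow> 'a \<Rightarrow> real) \<Rightarrow> real \<Rightarrow> 'a set \<Rightarrow> 'a set" where
  "nbhd Z d r A = (\<Union>a\<in>A. Metric_space.mball Z d a r)"

definition hausdorff_distance ::
    "'a set \<Rightarrow> ('a \<Rightarrow> 'a \<Rightarrow> real) \<Rightarrow> 'a set \<Rightarrow> 'a set \<Rightarrow> ereal" where
  "hausdorff_distance Z d A B =
     Inf (ereal ` {r. 0 < r \<and> A \<subseteq> nbhd Z d r B \<and> B \<subseteq> nbhd Z d r A})"

definition isometric ::
    "'a set \<Rightarrow> ('a \<Rightarrow> 'a \<Rightarrow> real) \<Rightarrow> 'b set \<Rightarrow> ('b \<Rightarrow> 'b \<Rightarrow> real) \<Rightarrow> bool" where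
  "isometric X dX Y dY \<longleftrightarrow>
     (\<exists>f. bij_betw f X Y \<and> (\<forall>x\<in>X. \<forall>x'\<in>X. dY (f x) (f x') = dX x x'))"

definition GH_realization ::
    "'a set \<Rightarrow> ('a \<Rightarrow> 'a \<Rightarrow> real) \<Rightarrow> 'b set \<Rightarrow> ('b \<Rightarrow> 'b \<Rightarrow> real) \<Rightarrow> real \<Rightarrow>
     'c set \<Rightarrow> ('c \<Rightarrow> 'c \<Rightarrow> real) \<Rightarrow> bool" where
  "GH_realization X dX Y dY r Z d \<longleftrightarrow>
     Metric_space Z d \<and>
     (\<exists>X' Y'. X' \<subseteq> Z \<and> Y' \<subseteq> Z \<and> isometric X dX X' d \<and> isometric Y dY Y' d \<and>
        hausdorff_distance Z d X' Y' \<le> ereal r)"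

text \<open>HOL cannot quantify over the type of points of the ambient space \<open>Z\<close>, so its carrier is
  taken in the sum type. This is no restriction: see \<open>GH_realization_sum_type\<close>.\<close>

definition GH_distance ::
    "'a set \<Rightarrow> ('a \<Rightarrow> 'a \<Rightarrow> real) \<Rightarrow> 'b set \<Rightarrow> ('b \<Rightarrow> 'b \<Rightarrow> real) \<Rightarrow> ereal" where
  "GH_distance X dX Y dY =
     Inf (ereal ` {r. \<exists>(Z :: ('a + 'b) set) d. GH_realization X dX Y dY r Z d})"

lemma GH_realization_sum_type:
  fixes X :: "'a set" and Y :: "'b set" and Z :: "'c set"
  assumes "GH_realization X dX Y dY r Z d"
  shows "\<exists>(Z' :: ('a + 'b) set) d'. GH_realization X dX Y dY r Z' d'"
proof -
  from assms obtain X' Y' where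
    M: "Metric_space Z d" and sub: "X' \<subseteq> Z" "Y' \<subseteq> Z"
    and iso: "isometric X dX X' d" "isometric Y dY Y' d"
    and le: "hausdorff_distance Z d X' Y' \<le> ereal r"
    unfolding GH_realization_def by (elim conjE exE)
  from iso(1) obtain f where
    f: "bij_betw f X X'" "\<forall>x\<in>X. \<forall>x'\<in>X. d (f x) (f x') = dX x x'"
    unfolding isometric_def by (elim conjE exE)
  from iso(2) obtain g where
    g: "bij_betw g Y Y'" "\<forall>x\<in>Y. \<forall>x'\<in>Y. d (g x) (g x') = dY x x'"
    unfolding isometric_def by (elim conjE exE)
  interpret Metric_space Z d by (rule M)
  define h where "h = case_sum f g"
  define W where "W = Inl ` X \<union> Inr ` {y \<in> Y. g y \<notin> X'}"
  define e where "e = (\<lambda>p q. d (h p) (h q))"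
  have fX: "f ` X = X'" and gY: "g ` Y = Y'" and injf: "inj_on f X" and injg: "inj_on g Y"
    using f(1) g(1) by (simp_all add: bij_betw_def)
  have inj: "inj_on h W"
  proof (rule inj_onI)
    fix p q assume pq: "p \<in> W" "q \<in> W" "h p = h q"
    have fin: "f x \<in> X'" if "x \<in> X" for x using that fX by blast
    show "p = q"
    proof (cases p; cases q)
      fix x x' assume "p = Inl x" "q = Inl x'"
      then show ?thesis using pq injf unfolding W_def h_def inj_on_def by auto
    next
      fix x y assume "p = Inl x" "q = Inr y"
      then show ?thesis using pq fin[of x] unfolding W_def h_def by auto
    next
      fix y x assume "p = Inr y" "q = Inl x"
      then show ?thesis using pq fin[of x] unfolding W_def h_def by auto
    next
      fix y y' assume "p = Inr y" "q = Inr y'"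
      then show ?thesis using pq injg unfolding W_def h_def inj_on_def by auto
    qed
  qed
  have img: "h ` W = X' \<union> Y'"
  proof -
    have "h ` W = f ` X \<union> g ` {y \<in> Y. g y \<notin> X'}"
      unfolding W_def h_def by (simp add: image_Un image_image)
    also have "\<dots> = X' \<union> Y'" using fX gY by blast
    finally show ?thesis .
  qed
  have bij: "bij_betw h W (X' \<union> Y')" using inj img by (simp add: bij_betw_def)
  define k where "k = inv_into W h"
  have kh: "k p \<in> W \<and> h (k p) = p" if "p \<in> X' \<union> Y'" for p
    using that img unfolding k_def by (metis f_inv_into_f inv_into_into)
  have hk: "h p \<in> X' \<union> Y' \<and> k (h p) = p" if "p \<in> W" for p
  proof
    show "h p \<in> X' \<union> Y'" using that img by blast
    show "k (h p) = p" using that inj unfolding k_def by (simp only: inv_into_f_f)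
  qed
  have hZ: "h p \<in> Z" if "p \<in> W" for p using hk[OF that] sub by blast
  have MW: "Metric_space W e"
  proof
    show "e x y = 0 \<longleftrightarrow> x = y" if "x \<in> W" "y \<in> W" for x y
      unfolding e_def using zero[OF hZ[OF that(1)] hZ[OF that(2)]] inj_on_eq_iff[OF inj that]
      by (rule trans)
    show "e x z \<le> e x y + e y z" if "x \<in> W" "y \<in> W" "z \<in> W" for x y z
      unfolding e_def using hZ[OF that(1)] hZ[OF that(2)] hZ[OF that(3)] by (rule triangle)
    show "0 \<le> e x y" for x y by (simp add: e_def)
    show "e x y = e y x" for x y unfolding e_def by (rule commute)
  qed
  have transfer: "k ` A \<subseteq> nbhd W e s (k ` B)"
    if AB: "A \<subseteq> nbhd Z d s B" "A \<subseteq> X' \<union> Y'" "B \<subseteq> X' \<union> Y'" for A B s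
  proof
    fix p assume "p \<in> k ` A"
    then obtain a where a: "a \<in> A" "p = k a" by blast
    then obtain b where b: "b \<in> B" "d b a < s"
      using AB(1) unfolding nbhd_def mball_def by blast
    have "p \<in> Metric_space.mball W e (k b) s"
    proof -
      have "a \<in> X' \<union> Y'" "b \<in> X' \<union> Y'" using a b AB(2,3) by blast+
      then have "k a \<in> W" "k b \<in> W" "e (k b) (k a) < s"
        using kh[of a] kh[of b] b(2) unfolding e_def by simp_all
      then show ?thesis using a(2) by (simp add: Metric_space.mball_def[OF MW])
    qed
    then show "p \<in> nbhd W e s (k ` B)" using b unfolding nbhd_def by blast
  qed
  have "hausdorff_distance W e (k ` X') (k ` Y') \<le> hausdorff_distance Z d X' Y'"
    unfolding hausdorff_distance_def
    by (intro Inf_superset_mono image_mono Collect_mono impI conjI; elim conjE)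
      (assumption | rule transfer; blast)+
  with le have le': "hausdorff_distance W e (k ` X') (k ` Y') \<le> ereal r" by simp
  have injk: "inj_on k (X' \<union> Y')" by (rule inj_on_inverseI[of _ h]) (use kh in blast)
  have "isometric X dX (k ` X') e"
    unfolding isometric_def
  proof (intro exI[of _ "k \<circ> f"] conjI ballI)
    show "bij_betw (k \<circ> f) X (k ` X')"
      by (rule bij_betw_trans[OF f(1) inj_on_imp_bij_betw]) (rule inj_on_subset[OF injk], blast)
    show "e ((k \<circ> f) x) ((k \<circ> f) x') = dX x x'" if "x \<in> X" "x' \<in> X" for x x'
    proof -
      have "h (k (f x)) = f x" "h (k (f x')) = f x'" using that fX kh by blast+
      then show ?thesis using that f(2) unfolding e_def by simp
    qed
  qed
  moreover have "isometric Y dY (k ` Y') e"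
    unfolding isometric_def
  proof (intro exI[of _ "k \<circ> g"] conjI ballI)
    show "bij_betw (k \<circ> g) Y (k ` Y')"
      by (rule bij_betw_trans[OF g(1) inj_on_imp_bij_betw]) (rule inj_on_subset[OF injk], blast)
    show "e ((k \<circ> g) x) ((k \<circ> g) x') = dY x x'" if "x \<in> Y" "x' \<in> Y" for x x'
    proof -
      have "h (k (g x)) = g x" "h (k (g x')) = g x'" using that gY kh by blast+
      then show ?thesis using that g(2) unfolding e_def by simp
    qed
  qed
  moreover have "k ` X' \<subseteq> W" "k ` Y' \<subseteq> W" using kh by auto
  ultimately have "GH_realization X dX Y dY r W e"
    unfolding GH_realization_def using MW le' by blast
  then show ?thesis by blast
qed

section \<open>Minimal spanning trees and the mst-spectrum\<close>

text \<open>A graph on the vertex set \<open>V\<close> is given by its set \<open>E\<close> of edges, which are two-element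
  subsets of \<open>V\<close>. A cycle is listed without repeating its first vertex at the end. (The AFP
  notion \<open>Graph_Theory.tree\<close> is not used since it only excludes directed cycles.)\<close>

definition graph_on :: "'a set \<Rightarrow> 'a set set \<Rightarrow> bool" where
  "graph_on V E \<longleftrightarrow> (\<forall>e\<in>E. e \<subseteq> V \<and> card e = 2)"

definition graph_connected :: "'a set \<Rightarrow> 'a set set \<Rightarrow> bool" where
  "graph_connected V E \<longleftrightarrow> (\<forall>u\<in>V. \<forall>v\<in>V. (u, v) \<in> {(a, b). {a, b} \<in> E}\<^sup>*)"

definition graph_cycle :: "'a set set \<Rightarrow> 'a list \<Rightarrow> bool" where
  "graph_cycle E vs \<longleftrightarrow>
     3 \<le> length vs \<and> distinct vs \<and>
     (\<forall>i<length vs. {vs ! i, vs ! (Suc i mod length vs)} \<in> E)"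

definition tree_on :: "'a set \<Rightarrow> 'a set set \<Rightarrow> bool" where
  "tree_on V E \<longleftrightarrow> graph_on V E \<and> graph_connected V E \<and> (\<nexists>vs. graph_cycle E vs)"

definition edge_length :: "('a \<Rightarrow> 'a \<Rightarrow> real) \<Rightarrow> 'a set \<Rightarrow> real" where
  "edge_length d e = (THE r. \<exists>v w. e = {v, w} \<and> v \<noteq> w \<and> r = d v w)"

lemma (in Metric_space) edge_length_pair:
  assumes "v \<noteq> w"
  shows "edge_length d {v, w} = d v w"
  unfolding edge_length_def
  by (rule the_equality) (use assms in \<open>auto simp: doubleton_eq_iff commute\<close>)

definition graph_length :: "('a \<Rightarrow> 'a \<Rightarrow> real) \<Rightarrow> 'a set set \<Rightarrow> real" where
  "graph_length d E = (\<Sum>e\<in>E. edge_length d e)"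

definition minimal_spanning_tree :: "'a set \<Rightarrow> ('a \<Rightarrow> 'a \<Rightarrow> real) \<Rightarrow> 'a set set \<Rightarrow> bool" where
  "minimal_spanning_tree X d E \<longleftrightarrow>
     tree_on X E \<and> (\<forall>E'. tree_on X E' \<longrightarrow> graph_length d E \<le> graph_length d E')"

definition edge_lengths_decreasing :: "('a \<Rightarrow> 'a \<Rightarrow> real) \<Rightarrow> 'a set set \<Rightarrow> real list" where
  "edge_lengths_decreasing d E =
     rev (sorted_list_of_multiset (image_mset (edge_length d) (mset_set E)))"

text \<open>The choice of the minimal spanning tree does not affect the resulting vector.\<close>

definition mst_spectrum :: "'a set \<Rightarrow> ('a \<Rightarrow> 'a \<Rightarrow> real) \<Rightarrow> real list" where
  "mst_spectrum X d = edge_lengths_decreasing d (SOME E. minimal_spanning_tree X d E)"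

text \<open>The spectrum is numbered from \<open>1\<close> to \<open>card X - 1\<close>.\<close>

definition mst_sigma :: "'a set \<Rightarrow> ('a \<Rightarrow> 'a \<Rightarrow> real) \<Rightarrow> nat \<Rightarrow> real" where
  "mst_sigma X d i = mst_spectrum X d ! (i - 1)"

end

theory Submission
  imports Defs
begin

text \<open>Twice the Gromov--Hausdorff distance is the least distortion of a correspondence
  (\<open>GH_distance_eqI\<close>), and a correspondence between a simplex and \<open>X\<close> behaves like a partition of
  \<open>X\<close>: pairs inside a block cost their distance, pairs in different blocks cost the difference
  between their distance and \<open>\<lambda>\<close>. So one needs to know how well \<open>X\<close> splits into \<open>k\<close> blocks.

  The best splitting comes from a minimal spanning tree by deleting its \<open>k - 1\<close> longest edges
  (\<open>spectral_partition\<close>). Two points in one block are joined by a path of edges of length at most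
  \<open>\<sigma>\<^sub>k\<close>, hence are at distance at most \<open>\<sigma>\<^sub>k\<close> by the ultrametric inequality. Two points in
  different blocks are separated in the tree by a deleted edge; exchanging that edge for the edge
  between the two points gives another spanning tree, so by minimality their distance is at least
  the length of the deleted edge, which is at least \<open>\<sigma>\<^sub>k\<^sub>-\<^sub>1\<close>. In particular \<open>\<sigma>\<^sub>1\<close> is the diameter.

  If the simplex has \<open>k \<le> n\<close> points, matching them with the \<open>k\<close> blocks gives the upper bound. For
  the lower bounds the pigeonhole principle is applied to the neighbouring partitions. The
  partition into \<open>k + 1\<close> blocks yields \<open>k + 1\<close> points with pairwise distances at least \<open>\<sigma>\<^sub>k\<close>, two of
  which correspond to one vertex of the simplex, so the distortion is at least \<open>\<sigma>\<^sub>k\<close> if \<open>k < n\<close>. For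
  the partition into \<open>k - 1\<close> blocks, where \<open>k \<ge> 2\<close>, two different vertices of the simplex correspond to points of one
  block, so the distortion is at least \<open>\<lambda> - \<sigma>\<^sub>k\<^sub>-\<^sub>1\<close>. Comparing the diameters gives \<open>\<sigma>\<^sub>1 - \<lambda>\<close>.
  If the simplex is larger than \<open>X\<close>, two of its vertices share a point, which costs \<open>\<lambda>\<close>, and any
  surjection onto \<open>X\<close> attains the bound.\<close>

section \<open>Connectivity, cycles and bridges\<close>

definition linked :: "'a set set \<Rightarrow> ('a \<times> 'a) set" where
  "linked E = {(a, b). {a, b} \<in> E}\<^sup>*"

lemma linked_refl [simp]: "(x, x) \<in> linked E"
  by (simp add: linked_def)

lemma linked_trans: "(x, y) \<in> linked E \<Longrightarrow> (y, z) \<in> linked E \<Longrightarrow> (x, z) \<in> linked E"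
  unfolding linked_def by (rule rtrancl_trans)

lemma linked_sym: "(x, y) \<in> linked E \<Longrightarrow> (y, x) \<in> linked E"
proof -
  have "sym {(a, b). {a, b} \<in> E}" by (auto simp: sym_def insert_commute)
  then show "(x, y) \<in> linked E \<Longrightarrow> (y, x) \<in> linked E"
    unfolding linked_def by (metis sym_rtrancl symD)
qed

lemma linked_edge: "{x, y} \<in> E \<Longrightarrow> (x, y) \<in> linked E"
  unfolding linked_def by auto

lemma linked_mono: "(x, y) \<in> linked E \<Longrightarrow> E \<subseteq> F \<Longrightarrow> (x, y) \<in> linked F"
  unfolding linked_def by (rule subsetD[OF rtrancl_mono]) auto

lemma linked_empty: "(x, y) \<in> linked {} \<Longrightarrow> x = y"
  by (simp add: linked_def)

lemma linked_induct [consumes 1, case_names refl step]: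
  assumes "(x, y) \<in> linked E" "P x"
    "\<And>y z. (x, y) \<in> linked E \<Longrightarrow> {y, z} \<in> E \<Longrightarrow> P y \<Longrightarrow> P z"
  shows "P y"
  using assms unfolding linked_def by (induction rule: rtrancl_induct) auto

lemma linked_subset:
  assumes "(x, y) \<in> linked E" "\<And>a b. {a, b} \<in> E \<Longrightarrow> (a, b) \<in> linked F"
  shows "(x, y) \<in> linked F"
  using assms(1) by (induction rule: linked_induct) (auto intro: linked_trans assms(2))

lemma linked_remove_edge:
  assumes "(x, y) \<in> linked E"
  shows "(x, y) \<in> linked (E - {{u, v}}) \<or>
    (x, u) \<in> linked (E - {{u, v}}) \<and> (v, y) \<in> linked (E - {{u, v}}) \<or>
    (x, v) \<in> linked (E - {{u, v}}) \<and> (u, y) \<in> linked (E - {{u, v}})"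
  using assms
proof (induction rule: linked_induct)
  case refl
  then show ?case by simp
next
  case (step y z)
  show ?case
  proof (cases "{y, z} = {u, v}")
    case True
    then have "y = u \<and> z = v \<or> y = v \<and> z = u" by (auto simp: doubleton_eq_iff)
    then show ?thesis using step.IH by (auto intro: linked_refl)
  next
    case False
    then have "(y, z) \<in> linked (E - {{u, v}})" using step.hyps by (intro linked_edge) simp
    then show ?thesis using step.IH by (meson linked_trans)
  qed
qed

lemma linked_simple_path:
  assumes "(u, v) \<in> linked E"
  shows "\<exists>vs. vs \<noteq> [] \<and> hd vs = u \<and> last vs = v \<and> distinct vs \<and>
    successively (\<lambda>a b. {a, b} \<in> E) vs"
  using assms unfolding linked_def
proof (induction rule: converse_rtrancl_induct)
  case base
  show ?case by (rule exI[of _ "[v]"]) simp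
next
  case (step u w)
  then obtain vs where vs: "vs \<noteq> []" "hd vs = w" "last vs = v" "distinct vs"
    "successively (\<lambda>a b. {a, b} \<in> E) vs" by blast
  show ?case
  proof (cases "u \<in> set vs")
    case True
    then obtain ys zs where "vs = ys @ u # zs" by (meson split_list)
    then show ?thesis using vs
      by (intro exI[of _ "u # zs"]) (auto simp: successively_append_iff)
  next
    case False
    then show ?thesis using vs step.hyps
      by (intro exI[of _ "u # vs"]) (auto simp: successively_Cons)
  qed
qed

text \<open>An algebraic form of acyclicity: every edge disconnects its endpoints when it is removed. Unlike
  the absence of cyclic lists of vertices, it is easy to check after edges are added or removed.\<close>

definition bridges_only :: "'a set set \<Rightarrow> bool" where
  "bridges_only E \<longleftrightarrow> (\<forall>u v. {u, v} \<in> E \<longrightarrow> (u, v) \<notin> linked (E - {{u, v}}))"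

text \<open>A simple path that avoids an edge and joins its endpoints closes up with this edge to a
  cycle, and conversely a cycle minus one of its edges is such a path.\<close>

lemma acyclic_iff_bridges_only:
  assumes "graph_on V E"
  shows "(\<nexists>vs. graph_cycle E vs) \<longleftrightarrow> bridges_only E"
proof
  assume ac: "\<nexists>vs. graph_cycle E vs"
  show "bridges_only E"
    unfolding bridges_only_def
  proof (intro allI impI notI)
    fix u v assume uv: "{u, v} \<in> E" and l: "(u, v) \<in> linked (E - {{u, v}})"
    have "card {u, v} = 2" using assms uv unfolding graph_on_def by blast
    then have ne: "u \<noteq> v" by auto
    from linked_simple_path[OF l] obtain vs where vs: "vs \<noteq> []" "hd vs = u" "last vs = v"
      "distinct vs" "successively (\<lambda>a b. {a, b} \<in> E - {{u, v}}) vs" by blast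
    have nth: "{vs ! i, vs ! Suc i} \<in> E - {{u, v}}" if "Suc i < length vs" for i
      using vs(5) that by (simp add: successively_conv_nth)
    have h: "vs ! 0 = u" "vs ! (length vs - 1) = v"
      using vs by (simp_all add: hd_conv_nth last_conv_nth)
    \<comment> \<open>a path with two vertices would be the removed edge itself\<close>
    have "length vs \<noteq> 0" using vs(1) by simp
    moreover have "length vs \<noteq> 1" using h ne by auto
    moreover have "length vs \<noteq> 2" using h nth[of 0] by auto
    ultimately have len: "3 \<le> length vs" by linarith
    have "{vs ! i, vs ! (Suc i mod length vs)} \<in> E" if "i < length vs" for i
    proof (cases "Suc i < length vs")
      case True
      then show ?thesis using nth[of i] by simp
    next
      case False
      then have "Suc i = length vs" using that by simp
      then have "i = length vs - 1" "Suc i mod length vs = 0" by auto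
      then show ?thesis using h uv by (simp add: insert_commute)
    qed
    then have "graph_cycle E vs" unfolding graph_cycle_def using len vs(4) by blast
    with ac show False by blast
  qed
next
  assume b: "bridges_only E"
  show "\<nexists>vs. graph_cycle E vs"
  proof
    assume "\<exists>vs. graph_cycle E vs"
    then obtain vs where vs: "3 \<le> length vs" "distinct vs"
      "\<forall>i<length vs. {vs ! i, vs ! (Suc i mod length vs)} \<in> E"
      unfolding graph_cycle_def by blast
    define l where "l = length vs - 1"
    have l: "Suc l = length vs" "2 \<le> l" using vs(1) unfolding l_def by auto
    have e: "{vs ! 0, vs ! l} \<in> E" using vs(3)[rule_format, of l] l by (simp add: insert_commute)
    have "(vs ! 0, vs ! i) \<in> linked (E - {{vs ! 0, vs ! l}})" if "i \<le> l" for i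
      using that
    proof (induction i)
      case 0
      then show ?case by simp
    next
      case (Suc i)
      have "{vs ! i, vs ! Suc i} \<in> E" using vs(3)[rule_format, of i] Suc.prems l by simp
      moreover have "vs ! Suc i \<noteq> vs ! 0" "vs ! i = vs ! 0 \<longleftrightarrow> i = 0" "vs ! Suc i = vs ! l \<longleftrightarrow> Suc i = l"
        using Suc.prems l vs(1) nth_eq_iff_index_eq[OF vs(2), of "Suc i" 0]
          nth_eq_iff_index_eq[OF vs(2), of i 0] nth_eq_iff_index_eq[OF vs(2), of "Suc i" l] by linarith+
      then have "{vs ! i, vs ! Suc i} \<noteq> {vs ! 0, vs ! l}"
        using l(2) by (auto simp: doubleton_eq_iff)
      ultimately have "(vs ! i, vs ! Suc i) \<in> linked (E - {{vs ! 0, vs ! l}})"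
        by (intro linked_edge) simp
      then show ?case using Suc by (meson Suc_leD linked_trans)
    qed
    then show False using b e unfolding bridges_only_def by blast
  qed
qed

lemma tree_on_iff_bridges_only:
  "tree_on V E \<longleftrightarrow> graph_on V E \<and> (\<forall>u\<in>V. \<forall>v\<in>V. (u, v) \<in> linked E) \<and> bridges_only E"
  using acyclic_iff_bridges_only[of V E]
  unfolding tree_on_def graph_connected_def linked_def by blast

section \<open>Minimal spanning trees\<close>

lemma graph_on_finite:
  assumes "finite V" "graph_on V E"
  shows "E \<in> Pow (Pow V)" "finite E"
proof -
  show "E \<in> Pow (Pow V)" using assms unfolding graph_on_def by auto
  then show "finite E" using assms by (auto intro: finite_subset)
qed

text \<open>A connected graph with the least number of edges is a tree, since deleting an edge that is
  not a bridge would keep it connected.\<close>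

lemma spanning_tree_exists:
  assumes "finite V"
  shows "\<exists>E. tree_on V E"
proof -
  let ?conn = "\<lambda>E. graph_on V E \<and> (\<forall>u\<in>V. \<forall>v\<in>V. (u, v) \<in> linked E)"
  have "?conn {e. e \<subseteq> V \<and> card e = 2}"
  proof (intro conjI ballI)
    fix u v assume "u \<in> V" "v \<in> V"
    then show "(u, v) \<in> linked {e. e \<subseteq> V \<and> card e = 2}"
      by (cases "u = v") (auto intro: linked_edge)
  qed (simp add: graph_on_def)
  then obtain E where E: "?conn E" and min: "\<And>F. ?conn F \<Longrightarrow> card E \<le> card F"
    using ex_has_least_nat[of ?conn _ card] by blast
  have "bridges_only E"
    unfolding bridges_only_def
  proof (intro allI impI notI)
    fix u v assume uv: "{u, v} \<in> E" and l: "(u, v) \<in> linked (E - {{u, v}})"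
    have "(x, y) \<in> linked (E - {{u, v}})" if "x \<in> V" "y \<in> V" for x y
    proof -
      have "(x, y) \<in> linked E" using E that by blast
      from linked_remove_edge[OF this, of u v] l show ?thesis by (meson linked_trans linked_sym)
    qed
    then have "?conn (E - {{u, v}})" using E by (auto simp: graph_on_def)
    from min[OF this] uv graph_on_finite(2)[OF assms] E show False
      by (metis card_Diff1_less not_le)
  qed
  with E show ?thesis by (auto simp: tree_on_iff_bridges_only)
qed

lemma minimal_spanning_tree_exists:
  assumes "finite V"
  shows "\<exists>E. minimal_spanning_tree V d E"
proof -
  let ?T = "{E. tree_on V E}"
  have "?T \<subseteq> Pow (Pow V)" using graph_on_finite(1)[OF assms] unfolding tree_on_def by blast
  then have "finite ?T" using assms by (meson finite_Pow_iff finite_subset)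
  moreover have "?T \<noteq> {}" using spanning_tree_exists[OF assms] by blast
  ultimately obtain E where "is_arg_min (graph_length d) (\<lambda>E. E \<in> ?T) E"
    using ex_is_arg_min_if_finite by blast
  then show ?thesis
    unfolding minimal_spanning_tree_def is_arg_min_linorder by auto
qed

text \<open>Since \<open>x\<close> and \<open>y\<close> lie on different sides of the edge \<open>uv\<close>, the new edge \<open>xy\<close> reconnects the two
  components that are left by the removal of \<open>uv\<close>, and it closes no cycle.\<close>

lemma tree_exchange:
  assumes T: "tree_on V E" and e: "{u, v} \<in> E" and xy: "x \<in> V" "y \<in> V"
    and sep: "(x, y) \<notin> linked (E - {{u, v}})"
  shows "tree_on V (insert {x, y} (E - {{u, v}}))"
proof -
  let ?D = "E - {{u, v}}"
  let ?F = "insert {x, y} ?D"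
  from T have g: "graph_on V E" and c: "\<And>p q. p \<in> V \<Longrightarrow> q \<in> V \<Longrightarrow> (p, q) \<in> linked E"
    and b: "\<And>p q. {p, q} \<in> E \<Longrightarrow> (p, q) \<notin> linked (E - {{p, q}})"
    by (auto simp: tree_on_iff_bridges_only bridges_only_def)
  have "x \<noteq> y" using sep by auto
  then have gF: "graph_on V ?F" using g xy by (auto simp: graph_on_def)
  have xyF: "(x, y) \<in> linked ?F" by (rule linked_edge) simp
  have DF: "(p, q) \<in> linked ?F" if "(p, q) \<in> linked ?D" for p q
    using that by (rule linked_mono) blast
  have uvF: "(u, v) \<in> linked ?F"
    using linked_remove_edge[OF c[OF xy], of u v] sep xyF
    by (meson DF linked_sym linked_trans)
  have cF: "(p, q) \<in> linked ?F" if "p \<in> V" "q \<in> V" for p q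
    using c[OF that]
  proof (rule linked_subset)
    fix a b assume ab: "{a, b} \<in> E"
    show "(a, b) \<in> linked ?F"
    proof (cases "{a, b} = {u, v}")
      case True
      then show ?thesis using uvF by (auto simp: doubleton_eq_iff intro: linked_sym)
    next
      case False
      then show ?thesis using ab by (intro linked_edge) simp
    qed
  qed
  have "bridges_only ?F"
    unfolding bridges_only_def
  proof (intro allI impI notI)
    fix p q assume pq: "{p, q} \<in> ?F" and l: "(p, q) \<in> linked (?F - {{p, q}})"
    show False
    proof (cases "{p, q} = {x, y}")
      case True
      then have "(p, q) \<in> linked ?D" using l by (auto intro: linked_mono)
      then show False using True sep by (auto simp: doubleton_eq_iff dest: linked_sym)
    next
      case False
      then have pqD: "{p, q} \<in> ?D" using pq by simp
      have sub: "(s, t) \<in> linked (E - {{p, q}})" "(s, t) \<in> linked ?D"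
        if "(s, t) \<in> linked (?F - {{p, q}} - {{x, y}})" for s t
        using that by (auto intro: linked_mono)
      \<comment> \<open>a detour around \<open>pq\<close> has to use \<open>xy\<close>; together with \<open>pq\<close> the rest of the detour
        would link \<open>x\<close> to \<open>y\<close> in the old tree without \<open>uv\<close>\<close>
      have "(p, q) \<notin> linked (?F - {{p, q}} - {{x, y}})" using sub(1) b pqD by blast
      then have "(x, y) \<in> linked ?D"
        using linked_remove_edge[OF l, of x y] sub(2) linked_edge[OF pqD]
        by (meson linked_sym linked_trans)
      then show False using sep by blast
    qed
  qed
  then show ?thesis using gF cF by (auto simp: tree_on_iff_bridges_only)
qed

text \<open>Otherwise exchanging \<open>uv\<close> for \<open>xy\<close> would shorten the tree.\<close>

lemma minimal_spanning_tree_cut: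
  assumes M: "Metric_space V d" and fin: "finite V" and T: "minimal_spanning_tree V d E"
    and e: "{u, v} \<in> E" and xy: "x \<in> V" "y \<in> V"
    and sep: "(x, y) \<notin> linked (E - {{u, v}})"
  shows "edge_length d {u, v} \<le> d x y"
proof -
  let ?D = "E - {{u, v}}"
  from T have T': "tree_on V E" and
    min: "\<And>F. tree_on V F \<Longrightarrow> graph_length d E \<le> graph_length d F"
    by (auto simp: minimal_spanning_tree_def)
  have finE: "finite E" using T' graph_on_finite(2)[OF fin] by (auto simp: tree_on_def)
  have "x \<noteq> y" using sep by auto
  have "{x, y} \<notin> ?D" using sep linked_edge by metis
  then have "graph_length d (insert {x, y} ?D) = d x y + graph_length d ?D"
    using finE \<open>x \<noteq> y\<close> by (simp add: graph_length_def Metric_space.edge_length_pair[OF M])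
  moreover have "graph_length d E = edge_length d {u, v} + graph_length d ?D"
    using finE e by (simp add: graph_length_def sum.remove)
  ultimately show ?thesis using min[OF tree_exchange[OF T' e xy sep]] by simp
qed

section \<open>Partitions of an ultrametric space along its spectrum\<close>

text \<open>The spectrum only records the lengths; this recovers an order of the edges themselves that
  produces it, so that one can speak of deleting the longest edges.\<close>

lemma edge_lengths_decreasing_enum:
  assumes "finite E"
  obtains es where "distinct es" "set es = E" "map (edge_length d) es = edge_lengths_decreasing d E"
    "sorted_wrt (\<ge>) (edge_lengths_decreasing d E)"
proof -
  obtain xs where xs: "set xs = E" "distinct xs" using finite_distinct_list[OF assms] by blast
  define ys where "ys = sort_key (edge_length d) xs"
  have "mset ys = mset_set E"
    using xs by (simp add: ys_def flip: mset_set_set)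
  then have "image_mset (edge_length d) (mset_set E) = mset (map (edge_length d) ys)" by simp
  moreover have "sorted (map (edge_length d) ys)" by (simp add: ys_def)
  ultimately have eq: "sorted_list_of_multiset (image_mset (edge_length d) (mset_set E))
      = map (edge_length d) ys"
    by (metis sorted_list_of_multiset_mset sorted_sort_id)
  show thesis
  proof (rule that[of "rev ys"])
    show "distinct (rev ys)" "set (rev ys) = E" using xs by (simp_all add: ys_def)
    show "map (edge_length d) (rev ys) = edge_lengths_decreasing d E"
      by (simp add: edge_lengths_decreasing_def eq rev_map)
    show "sorted_wrt (\<ge>) (edge_lengths_decreasing d E)"
      by (simp add: edge_lengths_decreasing_def eq sorted_wrt_rev ys_def)
  qed
qed

lemma ultrametric_linked_le:
  assumes U: "ultrametric_space X d" and g: "graph_on X F" and x: "x \<in> X"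
    and c: "\<And>e. e \<in> F \<Longrightarrow> edge_length d e \<le> c" and c0: "0 \<le> c"
    and l: "(x, y) \<in> linked F"
  shows "y \<in> X \<and> d x y \<le> c"
  using l
proof (induction rule: linked_induct)
  case refl
  from U have "Metric_space X d" by (simp add: ultrametric_space_def)
  then show ?case using x c0 Metric_space.zero by fastforce
next
  case (step y z)
  interpret Metric_space X d using U by (simp add: ultrametric_space_def)
  have yz: "y \<in> X" "z \<in> X" "y \<noteq> z"
    using g step.hyps(2) unfolding graph_on_def by fastforce+
  have "d y z \<le> c" using c[OF step.hyps(2)] edge_length_pair[OF yz(3)] by simp
  moreover have "d x z \<le> max (d x y) (d y z)"
    using U x yz by (simp add: ultrametric_space_def)
  ultimately show ?case using step.IH yz by simp
qed

text \<open>The blocks are the components of the remaining forest, numbered by \<open>f\<close>. Each removed edge is a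
  bridge, so it splits exactly one block into two, which is the induction step. The lower bound for
  distances between different blocks is inherited for pairs that were separated earlier, because the
  lengths decrease; for pairs that the last edge separates it is the cut property of the tree.\<close>

lemma removing_longest_edges:
  assumes M: "Metric_space X d" and fin: "finite X" and ne: "X \<noteq> {}"
    and T: "minimal_spanning_tree X d E"
    and es: "distinct es" "set es = E" "sorted_wrt (\<ge>) (map (edge_length d) es)"
    and k: "k \<le> length es"
  shows "\<exists>f::'a \<Rightarrow> nat. f ` X = {..k} \<and>
    (\<forall>x\<in>X. \<forall>y\<in>X. f x = f y \<longleftrightarrow> (x, y) \<in> linked (set (drop k es))) \<and>
    (\<forall>x\<in>X. \<forall>y\<in>X. f x \<noteq> f y \<longrightarrow> 0 < k \<and> edge_length d (es ! (k - 1)) \<le> d x y)"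
  using k
proof (induction k)
  case 0
  have "\<forall>x\<in>X. \<forall>y\<in>X. (x, y) \<in> linked E"
    using T by (simp add: minimal_spanning_tree_def tree_on_iff_bridges_only)
  then show ?case using es ne by (intro exI[of _ "\<lambda>_. 0"]) auto
next
  case (Suc k)
  define F where "F = set (drop k es)"
  define G where "G = set (drop (Suc k) es)"
  have klt: "k < length es" using Suc.prems by simp
  from Suc obtain f :: "'a \<Rightarrow> nat" where f: "f ` X = {..k}"
    and ff: "\<And>x y. x \<in> X \<Longrightarrow> y \<in> X \<Longrightarrow> f x = f y \<longleftrightarrow> (x, y) \<in> linked F"
    and fl: "\<And>x y. x \<in> X \<Longrightarrow> y \<in> X \<Longrightarrow> f x \<noteq> f y \<Longrightarrow> 0 < k \<and> edge_length d (es ! (k - 1)) \<le> d x y"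
    unfolding F_def by auto
  have eE: "es ! k \<in> E" using klt es by auto
  have TE: "graph_on X E" "bridges_only E"
    using T by (simp_all add: minimal_spanning_tree_def tree_on_iff_bridges_only)
  then obtain u v where uv: "es ! k = {u, v}" "u \<noteq> v"
    using eE unfolding graph_on_def by (metis card_2_iff)
  have uvX: "u \<in> X" "v \<in> X" using TE eE uv unfolding graph_on_def by auto
  have dk: "drop k es = es ! k # drop (Suc k) es" using klt by (simp add: Cons_nth_drop_Suc)
  have "distinct (drop k es)" using es by simp
  then have G: "G = F - {{u, v}}" unfolding F_def G_def dk using uv by auto
  have GE: "G \<subseteq> E - {{u, v}}" unfolding G F_def using es set_drop_subset by fastforce
  have FG: "(x, y) \<in> linked F" if "(x, y) \<in> linked G" for x y
    using that by (rule linked_mono) (auto simp: G)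
  have uvE: "(u, v) \<notin> linked (E - {{u, v}})" using TE eE uv by (simp add: bridges_only_def)
  then have uvG: "(u, v) \<notin> linked G" using GE linked_mono by metis
  have uvF: "f u = f v"
    using ff[OF uvX] linked_edge[of u v F] uv(1) unfolding F_def dk by simp
  \<comment> \<open>the side of \<open>u\<close> becomes the new block, the side of \<open>v\<close> keeps the old number\<close>
  define h where "h = (\<lambda>x. if (x, u) \<in> linked G then Suc k else f x)"
  have fX: "f x \<le> k" if "x \<in> X" for x using f that by auto
  have h_iff: "h x = h y \<longleftrightarrow> (x, y) \<in> linked G" if "x \<in> X" "y \<in> X" for x y
  proof
    assume eq: "h x = h y"
    show "(x, y) \<in> linked G"
    proof (cases "(x, u) \<in> linked G")
      case True
      then have "(y, u) \<in> linked G" using eq fX[OF that(2)] by (auto simp: h_def split: if_splits)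
      then show ?thesis using True by (meson linked_sym linked_trans)
    next
      case False
      then have yu: "(y, u) \<notin> linked G" using eq fX[OF that(1)] by (auto simp: h_def split: if_splits)
      then have "(x, y) \<in> linked F" using eq False ff[OF that] by (simp add: h_def)
      from linked_remove_edge[OF this, of u v] False yu show ?thesis
        unfolding G by (meson linked_sym)
    qed
  next
    assume l: "(x, y) \<in> linked G"
    then have "f x = f y" using ff[OF that] FG by blast
    moreover have "(x, u) \<in> linked G \<longleftrightarrow> (y, u) \<in> linked G"
      using l by (meson linked_sym linked_trans)
    ultimately show "h x = h y" by (simp add: h_def)
  qed
  have "h ` X = {..Suc k}"
  proof (intro equalityI subsetI)
    fix i assume "i \<in> h ` X"
    then show "i \<in> {..Suc k}" using fX by (fastforce simp: h_def split: if_splits)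
  next
    fix i assume i: "i \<in> {..Suc k}"
    show "i \<in> h ` X"
    proof (cases "i = Suc k")
      case True
      then show ?thesis using uvX by (intro image_eqI[of _ _ u]) (simp_all add: h_def)
    next
      case False
      then have "i \<in> f ` X" using f i by auto
      then obtain x where x: "x \<in> X" "i = f x" by blast
      show ?thesis
      proof (cases "(x, u) \<in> linked G")
        case True
        then have "f x = f u" using FG ff x uvX by blast
        moreover have "h v = f v" using uvG by (auto simp: h_def dest: linked_sym)
        ultimately show ?thesis using x uvX uvF by (intro image_eqI[of _ _ v]) simp_all
      next
        case False
        then show ?thesis using x by (intro image_eqI[of _ _ x]) (simp_all add: h_def)
      qed
    qed
  qed
  moreover have "edge_length d (es ! k) \<le> d x y" if xy: "x \<in> X" "y \<in> X" "h x \<noteq> h y" for x y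
  proof (cases "f x = f y")
    case False
    then have "0 < k" "edge_length d (es ! (k - 1)) \<le> d x y" using fl xy by blast+
    moreover have "edge_length d (es ! k) \<le> edge_length d (es ! (k - 1))"
      using sorted_wrt_nth_less[OF es(3), of "k - 1" k] \<open>0 < k\<close> klt by simp
    ultimately show ?thesis by simp
  next
    case True
    have sep: "(x, y) \<notin> linked G" using h_iff xy by blast
    have lF: "(x, y) \<in> linked F" using True ff xy by blast
    have GE': "(p, q) \<in> linked (E - {{u, v}})" if "(p, q) \<in> linked G" for p q
      using that GE by (rule linked_mono)
    \<comment> \<open>the forest path from \<open>x\<close> to \<open>y\<close> runs through \<open>uv\<close>, so a link avoiding \<open>uv\<close> in the whole
      tree would close a cycle through \<open>uv\<close>\<close>
    have "(x, y) \<notin> linked (E - {{u, v}})"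
    proof
      assume l: "(x, y) \<in> linked (E - {{u, v}})"
      have "(x, u) \<in> linked G \<and> (v, y) \<in> linked G \<or> (x, v) \<in> linked G \<and> (u, y) \<in> linked G"
        using linked_remove_edge[OF lF, of u v] sep unfolding G by blast
      then have "(u, v) \<in> linked (E - {{u, v}})" using l GE'
        by (meson linked_sym linked_trans)
      then show False using uvE by blast
    qed
    then show ?thesis
      using minimal_spanning_tree_cut[OF M fin T, of u v x y] eE uv xy by simp
  qed
  ultimately show ?case using h_iff unfolding G_def by (intro exI[of _ h]) auto
qed

text \<open>For \<open>k = card X\<close> there is no \<open>\<sigma>\<^sub>k\<close>: all edges have been deleted and the blocks are single
  points. For \<open>k = 1\<close> there is only one block, so no pair is separated and \<open>\<sigma>\<^sub>0\<close> never occurs.\<close>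

lemma spectral_partition:
  assumes U: "ultrametric_space X d" and fin: "finite X" and k: "1 \<le> k" "k \<le> card X"
  obtains f :: "'a \<Rightarrow> nat" where "f ` X = {..<k}"
    "\<And>x y. x \<in> X \<Longrightarrow> y \<in> X \<Longrightarrow> f x = f y \<Longrightarrow> k < card X \<Longrightarrow> d x y \<le> mst_sigma X d k"
    "\<And>x y. x \<in> X \<Longrightarrow> y \<in> X \<Longrightarrow> f x = f y \<Longrightarrow> k = card X \<Longrightarrow> x = y"
    "\<And>x y. x \<in> X \<Longrightarrow> y \<in> X \<Longrightarrow> f x \<noteq> f y \<Longrightarrow> 1 < k \<and> mst_sigma X d (k - 1) \<le> d x y"
proof -
  have M: "Metric_space X d" using U by (simp add: ultrametric_space_def)
  have ne: "X \<noteq> {}" using k by auto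
  define E where "E = (SOME E. minimal_spanning_tree X d E)"
  have T: "minimal_spanning_tree X d E"
    unfolding E_def using minimal_spanning_tree_exists[OF fin] by (rule someI_ex)
  then have g: "graph_on X E" by (simp add: minimal_spanning_tree_def tree_on_def)
  obtain es where es: "distinct es" "set es = E"
    "map (edge_length d) es = edge_lengths_decreasing d E"
    "sorted_wrt (\<ge>) (edge_lengths_decreasing d E)"
    using edge_lengths_decreasing_enum[OF graph_on_finite(2)[OF fin g]] by blast
  have srt: "sorted_wrt (\<ge>) (map (edge_length d) es)" using es by simp
  have sig: "mst_sigma X d i = edge_length d (es ! (i - 1))" if "i - 1 < length es" for i
    using that es(3) unfolding mst_sigma_def mst_spectrum_def E_def[symmetric]
    by (metis nth_map)
  note remove = removing_longest_edges[OF M fin ne T es(1,2) srt]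
  \<comment> \<open>deleting all edges leaves one block per point, which counts the edges of the tree\<close>
  have card: "card X = Suc (length es)"
  proof -
    from remove[OF order_refl] obtain f :: "'a \<Rightarrow> nat" where f: "f ` X = {..length es}"
      "\<forall>x\<in>X. \<forall>y\<in>X. f x = f y \<longleftrightarrow> (x, y) \<in> linked {}" by auto
    then have "inj_on f X" by (auto simp: inj_on_def dest: linked_empty)
    then have "card X = card {..length es}" using f(1) card_image by metis
    then show ?thesis by simp
  qed
  have "k - 1 \<le> length es" using k card by simp
  from remove[OF this] obtain f :: "'a \<Rightarrow> nat" where f: "f ` X = {..k - 1}"
    "\<And>x y. x \<in> X \<Longrightarrow> y \<in> X \<Longrightarrow> f x = f y \<longleftrightarrow> (x, y) \<in> linked (set (drop (k - 1) es))"
    "\<And>x y. x \<in> X \<Longrightarrow> y \<in> X \<Longrightarrow> f x \<noteq> f y \<Longrightarrow>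
       0 < k - 1 \<and> edge_length d (es ! (k - 1 - 1)) \<le> d x y" by metis
  show thesis
  proof (rule that[of f])
    have "{..k - 1} = {..<k}" using k by auto
    then show "f ` X = {..<k}" using f by simp
  next
    fix x y assume xy: "x \<in> X" "y \<in> X" "f x = f y" and kc: "k < card X"
    then have kl: "k - 1 < length es" using card k by simp
    have "edge_length d e \<le> mst_sigma X d k" if "e \<in> set (drop (k - 1) es)" for e
    proof -
      from that obtain j where j: "j < length es - (k - 1)" "e = es ! (k - 1 + j)"
        by (auto simp: in_set_conv_nth)
      then show ?thesis
        using sorted_wrt_nth_less[OF srt, of "k - 1" "k - 1 + j"] kl sig[OF kl]
        by (cases "j = 0") auto
    qed
    moreover have "0 \<le> mst_sigma X d k"
    proof -
      have "es ! (k - 1) \<in> E" using kl es by auto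
      then have "card (es ! (k - 1)) = 2" using g by (simp add: graph_on_def)
      then obtain a b where "es ! (k - 1) = {a, b}" "a \<noteq> b" by (auto simp: card_2_iff)
      then show ?thesis
        using sig[OF kl] Metric_space.edge_length_pair[OF M] Metric_space.nonneg[OF M] by simp
    qed
    moreover have "graph_on X (set (drop (k - 1) es))"
      using g es(2) set_drop_subset[of "k - 1" es] unfolding graph_on_def by auto
    ultimately show "d x y \<le> mst_sigma X d k"
      using ultrametric_linked_le[OF U _ xy(1)] f(2) xy by blast
  next
    fix x y assume xy: "x \<in> X" "y \<in> X" "f x = f y" and "k = card X"
    then have "(x, y) \<in> linked {}" using f(2)[of x y] card by simp
    then show "x = y" by (rule linked_empty)
  next
    fix x y assume "x \<in> X" "y \<in> X" "f x \<noteq> f y"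
    from f(3)[OF this] show "1 < k \<and> mst_sigma X d (k - 1) \<le> d x y"
      using sig[of "k - 1"] k card by auto
  qed
qed

section \<open>Gromov--Hausdorff distance and correspondences\<close>

definition correspondence :: "'a set \<Rightarrow> 'b set \<Rightarrow> ('a \<times> 'b) set \<Rightarrow> bool" where
  "correspondence A B R \<longleftrightarrow> R \<subseteq> A \<times> B \<and> fst ` R = A \<and> snd ` R = B"

text \<open>Upper bounds are used instead of the distortion itself, since a supremum over an unbounded
  set of reals is unspecified.\<close>

definition distortion_le ::
    "('a \<Rightarrow> 'a \<Rightarrow> real) \<Rightarrow> ('b \<Rightarrow> 'b \<Rightarrow> real) \<Rightarrow> ('a \<times> 'b) set \<Rightarrow> real \<Rightarrow> bool" where
  "distortion_le dA dB R c \<longleftrightarrow> (\<forall>(a, b)\<in>R. \<forall>(a', b')\<in>R. \<bar>dA a a' - dB b b'\<bar> \<le> c)"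

lemma correspondenceD:
  assumes "correspondence A B R"
  shows "(a, b) \<in> R \<Longrightarrow> a \<in> A" "(a, b) \<in> R \<Longrightarrow> b \<in> B"
    "a \<in> A \<Longrightarrow> \<exists>b. (a, b) \<in> R" "b \<in> B \<Longrightarrow> \<exists>a. (a, b) \<in> R"
  using assms unfolding correspondence_def by force+

lemma distortion_leD:
  "distortion_le dA dB R c \<Longrightarrow> (a, b) \<in> R \<Longrightarrow> (a', b') \<in> R \<Longrightarrow> \<bar>dA a a' - dB b b'\<bar> \<le> c"
  unfolding distortion_le_def by blast

text \<open>Points at distance less than \<open>s\<close> in the ambient space are declared to correspond; two
  applications of the triangle inequality bound the distortion. The strict inequality \<open>r < s\<close> is
  there because the infimum that defines the Hausdorff distance need not be attained.\<close>

lemma GH_realization_imp_correspondence: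
  assumes G: "GH_realization A dA B dB r Z d" and rs: "r < s"
  shows "\<exists>R. correspondence A B R \<and> distortion_le dA dB R (2 * s)"
proof -
  from G obtain A' B' where M: "Metric_space Z d" and sub: "A' \<subseteq> Z" "B' \<subseteq> Z"
    and iso: "isometric A dA A' d" "isometric B dB B' d"
    and le: "hausdorff_distance Z d A' B' \<le> ereal r"
    unfolding GH_realization_def by blast
  interpret Metric_space Z d by (rule M)
  from iso obtain f g where f: "bij_betw f A A'" "\<And>x y. x \<in> A \<Longrightarrow> y \<in> A \<Longrightarrow> d (f x) (f y) = dA x y"
    and g: "bij_betw g B B'" "\<And>x y. x \<in> B \<Longrightarrow> y \<in> B \<Longrightarrow> d (g x) (g y) = dB x y"
    unfolding isometric_def by blast
  have fA: "f ` A = A'" and gB: "g ` B = B'" using f g by (simp_all add: bij_betw_def)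
  have "hausdorff_distance Z d A' B' < ereal s"
    using le rs by (meson ereal_less_eq(3) le_less_trans less_ereal.simps(1))
  then obtain t where t: "t < s" "A' \<subseteq> nbhd Z d t B'" "B' \<subseteq> nbhd Z d t A'"
    unfolding hausdorff_distance_def Inf_less_iff by auto
  define R where "R = {(a, b). a \<in> A \<and> b \<in> B \<and> d (f a) (g b) < s}"
  have "\<exists>b. (a, b) \<in> R" if "a \<in> A" for a
  proof -
    have "f a \<in> nbhd Z d t B'" using that fA t(2) by blast
    then obtain b where "b \<in> B" "d (g b) (f a) < t" unfolding nbhd_def gB[symmetric] by auto
    then show ?thesis using that t(1) commute[of "g b" "f a"] unfolding R_def by auto
  qed
  moreover have "\<exists>a. (a, b) \<in> R" if "b \<in> B" for b
  proof -
    have "g b \<in> nbhd Z d t A'" using that gB t(3) by blast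
    then obtain a where "a \<in> A" "d (f a) (g b) < t" unfolding nbhd_def fA[symmetric] by auto
    then show ?thesis using that t(1) unfolding R_def by auto
  qed
  moreover have "R \<subseteq> A \<times> B" by (auto simp: R_def)
  ultimately have "correspondence A B R" unfolding correspondence_def by force
  moreover have "distortion_le dA dB R (2 * s)"
    unfolding distortion_le_def
  proof clarify
    fix a b a' b' assume "(a, b) \<in> R" "(a', b') \<in> R"
    then have ab: "a \<in> A" "b \<in> B" "d (f a) (g b) < s" "a' \<in> A" "b' \<in> B" "d (f a') (g b') < s"
      by (auto simp: R_def)
    have Z: "f a \<in> Z" "f a' \<in> Z" "g b \<in> Z" "g b' \<in> Z" using ab fA gB sub by blast+
    have "d (f a) (f a') \<le> d (f a) (g b) + d (g b) (g b') + d (g b') (f a')"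
      using triangle[OF Z(1,3,2)] triangle[OF Z(3,4,2)] by linarith
    moreover have "d (g b) (g b') \<le> d (g b) (f a) + d (f a) (f a') + d (f a') (g b')"
      using triangle[OF Z(3,1,4)] triangle[OF Z(1,2,4)] by linarith
    ultimately have "\<bar>d (f a) (f a') - d (g b) (g b')\<bar> \<le> 2 * s"
      using ab commute[of "f a" "g b"] commute[of "f a'" "g b'"] by linarith
    then show "\<bar>dA a a' - dB b b'\<bar> \<le> 2 * s" using f(2) g(2) ab by simp
  qed
  ultimately show ?thesis by blast
qed

text \<open>Corresponding points are joined by a segment of length \<open>r\<close>, and the distance between points of
  the two spaces is the infimum of the lengths of paths through one such segment.\<close>

definition cross_dist ::
    "('a \<Rightarrow> 'a \<Rightarrow> real) \<Rightarrow> ('b \<Rightarrow> 'b \<Rightarrow> real) \<Rightarrow> ('a \<times> 'b) set \<Rightarrow> real \<Rightarrow> 'a \<Rightarrow> 'b \<Rightarrow> real" where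
  "cross_dist dA dB R r a b = (INF (a', b')\<in>R. dA a a' + r + dB b' b)"

fun glued_dist ::
    "('a \<Rightarrow> 'a \<Rightarrow> real) \<Rightarrow> ('b \<Rightarrow> 'b \<Rightarrow> real) \<Rightarrow> ('a \<times> 'b) set \<Rightarrow> real \<Rightarrow> 'a + 'b \<Rightarrow> 'a + 'b \<Rightarrow> real"
  where
    "glued_dist dA dB R r (Inl a) (Inl a') = dA a a'"
  | "glued_dist dA dB R r (Inr b) (Inr b') = dB b b'"
  | "glued_dist dA dB R r (Inl a) (Inr b) = cross_dist dA dB R r a b"
  | "glued_dist dA dB R r (Inr b) (Inl a) = cross_dist dA dB R r a b"

text \<open>The only triangle inequalities that need the bound on the distortion are those for two points
  of one space and a third point of the other: passing over to the other space and back costs two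
  segments, that is \<open>2 * r\<close>, which makes up for any gain. Positivity of \<open>r\<close> keeps the two spaces
  disjoint.\<close>

lemma glued_metric:
  assumes MA: "Metric_space A dA" and MB: "Metric_space B dB"
    and R: "correspondence A B R" "R \<noteq> {}" and D: "distortion_le dA dB R (2 * r)" and r: "0 < r"
  shows "Metric_space (Inl ` A \<union> Inr ` B) (glued_dist dA dB R r)"
    and "(a, b) \<in> R \<Longrightarrow> cross_dist dA dB R r a b \<le> r"
proof -
  interpret A: Metric_space A dA by (rule MA)
  interpret B: Metric_space B dB by (rule MB)
  let ?c = "cross_dist dA dB R r"
  have lower: "?c a b \<le> dA a a' + r + dB b' b" if "(a', b') \<in> R" for a b a' b'
    unfolding cross_dist_def
    by (rule cINF_lower2[OF _ that]) (use r in \<open>auto intro!: bdd_belowI2[of _ 0] simp: add_nonneg_nonneg\<close>)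
  have greatest: "c \<le> ?c a b" if "\<And>a' b'. (a', b') \<in> R \<Longrightarrow> c \<le> dA a a' + r + dB b' b" for c a b
    unfolding cross_dist_def using R(2) that by (intro cINF_greatest) auto
  have pos: "r \<le> ?c a b" for a b
    by (rule greatest) simp
  show "?c a b \<le> r" if "(a, b) \<in> R" for a b
    using lower[OF that, of a b] correspondenceD(1,2)[OF R(1) that] by simp
  note RA = correspondenceD(1)[OF R(1)] and RB = correspondenceD(2)[OF R(1)]
  have AAB: "?c a b \<le> dA a a' + ?c a' b" if "a \<in> A" "a' \<in> A" for a a' b
  proof -
    have "?c a b - dA a a' \<le> ?c a' b"
    proof (rule greatest)
      fix p q assume pq: "(p, q) \<in> R"
      show "?c a b - dA a a' \<le> dA a' p + r + dB q b"
        using lower[OF pq, of a b] A.triangle[OF that RA[OF pq]] by linarith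
    qed
    then show ?thesis by simp
  qed
  have ABB: "?c a b \<le> ?c a b' + dB b' b" if "b \<in> B" "b' \<in> B" for a b b'
  proof -
    have "?c a b - dB b' b \<le> ?c a b'"
    proof (rule greatest)
      fix p q assume pq: "(p, q) \<in> R"
      show "?c a b - dB b' b \<le> dA a p + r + dB q b'"
        using lower[OF pq, of a b] B.triangle[OF RB[OF pq] that(2,1)] by linarith
    qed
    then show ?thesis by simp
  qed
  have ABA: "dA a a' \<le> ?c a b + ?c a' b" if "a \<in> A" "a' \<in> A" "b \<in> B" for a a' b
  proof -
    have "dA a a' - ?c a' b \<le> ?c a b"
    proof (rule greatest)
      fix p q assume pq: "(p, q) \<in> R"
      have "dA a a' - (dA a p + r + dB q b) \<le> ?c a' b"
      proof (rule greatest)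
        fix p' q' assume pq': "(p', q') \<in> R"
        have "dA p p' \<le> dB q q' + 2 * r" using distortion_leD[OF D pq pq'] by linarith
        moreover have "dB q q' \<le> dB q b + dB q' b"
          using B.triangle[OF RB[OF pq] that(3) RB[OF pq']] B.commute[of b q'] by linarith
        moreover have "dA a a' \<le> dA a p + dA p p' + dA a' p'"
          using A.triangle[OF that(1) RA[OF pq] that(2)] A.triangle[OF RA[OF pq] RA[OF pq'] that(2)]
            A.commute[of p' a'] by linarith
        ultimately show "dA a a' - (dA a p + r + dB q b) \<le> dA a' p' + r + dB q' b" by linarith
      qed
      then show "dA a a' - ?c a' b \<le> dA a p + r + dB q b" by linarith
    qed
    then show ?thesis by simp
  qed
  have BAB: "dB b b' \<le> ?c a b + ?c a b'" if "b \<in> B" "b' \<in> B" "a \<in> A" for b b' a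
  proof -
    have "dB b b' - ?c a b' \<le> ?c a b"
    proof (rule greatest)
      fix p q assume pq: "(p, q) \<in> R"
      have "dB b b' - (dA a p + r + dB q b) \<le> ?c a b'"
      proof (rule greatest)
        fix p' q' assume pq': "(p', q') \<in> R"
        have "dB q q' \<le> dA p p' + 2 * r" using distortion_leD[OF D pq pq'] by linarith
        moreover have "dA p p' \<le> dA a p + dA a p'"
          using A.triangle[OF RA[OF pq] that(3) RA[OF pq']] A.commute[of p a] by linarith
        moreover have "dB b b' \<le> dB q b + dB q q' + dB q' b'"
          using B.triangle[OF that(1) RB[OF pq] that(2)] B.triangle[OF RB[OF pq] RB[OF pq'] that(2)]
            B.commute[of b q] by linarith
        ultimately show "dB b b' - (dA a p + r + dB q b) \<le> dA a p' + r + dB q' b'" by linarith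
      qed
      then show "dB b b' - ?c a b' \<le> dA a p + r + dB q b" by linarith
    qed
    then show ?thesis by simp
  qed
  have nn: "0 \<le> ?c a b" "?c a b \<noteq> 0" for a b using pos[of a b] r by linarith+
  show "Metric_space (Inl ` A \<union> Inr ` B) (glued_dist dA dB R r)"
  proof
    show "0 \<le> glued_dist dA dB R r x y" for x y
      by (cases x; cases y) (simp_all add: nn)
    show "glued_dist dA dB R r x y = glued_dist dA dB R r y x" for x y
      by (cases x; cases y) (simp_all add: A.commute B.commute)
    show "glued_dist dA dB R r x y = 0 \<longleftrightarrow> x = y"
      if "x \<in> Inl ` A \<union> Inr ` B" "y \<in> Inl ` A \<union> Inr ` B" for x y
      using that by (auto simp: nn)
    show "glued_dist dA dB R r x z \<le> glued_dist dA dB R r x y + glued_dist dA dB R r y z"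
      if "x \<in> Inl ` A \<union> Inr ` B" "y \<in> Inl ` A \<union> Inr ` B" "z \<in> Inl ` A \<union> Inr ` B" for x y z
      using that A.triangle B.triangle AAB ABB ABA BAB A.commute B.commute
      by (elim UnE imageE; simp) (metis add.commute)+
  qed
qed

text \<open>Gluing needs segments of positive length, so it is done for each \<open>s > c / 2\<close> with a length \<open>r\<close>
  strictly between \<open>c / 2\<close> and \<open>s\<close>; the open balls of radius \<open>s\<close> then reach across the segments. This
  also covers \<open>c = 0\<close>.\<close>

lemma GH_distance_le:
  assumes MA: "Metric_space A dA" and MB: "Metric_space B dB" and ne: "A \<noteq> {}"
    and R: "correspondence A B R" and D: "distortion_le dA dB R c"
  shows "2 * GH_distance A dA B dB \<le> ereal c"
proof -
  obtain a b where "(a, b) \<in> R" using ne correspondenceD(3)[OF R] by blast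
  then have Rne: "R \<noteq> {}" and "\<bar>dA a a - dB b b\<bar> \<le> c" using distortion_leD[OF D] by blast+
  then have c0: "0 \<le> c" by linarith
  have le: "GH_distance A dA B dB \<le> ereal s" if s: "c / 2 < s" for s
  proof -
    define r where "r = (c / 2 + s) / 2"
    have r: "0 < r" "r < s" "c \<le> 2 * r" using s c0 by (auto simp: r_def field_simps)
    have "distortion_le dA dB R (2 * r)"
      using D r(3) unfolding distortion_le_def by fastforce
    note glue = glued_metric[OF MA MB R Rne this r(1)]
    let ?Z = "Inl ` A \<union> Inr ` B" and ?d = "glued_dist dA dB R r"
    interpret Z: Metric_space ?Z ?d by (rule glue(1))
    have "Inl ` A \<subseteq> nbhd ?Z ?d s (Inr ` B)"
    proof (clarify)
      fix a assume "a \<in> A"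
      then obtain b where b: "(a, b) \<in> R" using correspondenceD(3)[OF R] by blast
      have "b \<in> B" using correspondenceD(2)[OF R b] .
      then show "Inl a \<in> nbhd ?Z ?d s (Inr ` B)"
        using glue(2)[OF b] r \<open>a \<in> A\<close> unfolding nbhd_def by (auto intro!: bexI[of _ b])
    qed
    moreover have "Inr ` B \<subseteq> nbhd ?Z ?d s (Inl ` A)"
    proof (clarify)
      fix b assume "b \<in> B"
      then obtain a where a: "(a, b) \<in> R" using correspondenceD(4)[OF R] by blast
      have "a \<in> A" using correspondenceD(1)[OF R a] .
      then show "Inr b \<in> nbhd ?Z ?d s (Inl ` A)"
        using glue(2)[OF a] r \<open>b \<in> B\<close> unfolding nbhd_def by (auto intro!: bexI[of _ a])
    qed
    ultimately have "hausdorff_distance ?Z ?d (Inl ` A) (Inr ` B) \<le> ereal s"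
      unfolding hausdorff_distance_def using r by (intro Inf_lower) auto
    moreover have "isometric A dA (Inl ` A) ?d" "isometric B dB (Inr ` B) ?d"
      unfolding isometric_def
      by (rule exI[of _ Inl], simp add: bij_betw_def)
        (rule exI[of _ Inr], simp add: bij_betw_def)
    ultimately have "GH_realization A dA B dB s ?Z ?d"
      unfolding GH_realization_def using glue(1) by blast
    then show ?thesis unfolding GH_distance_def by (intro Inf_lower) blast
  qed
  have "GH_distance A dA B dB \<le> ereal (c / 2)"
  proof (rule ereal_le_epsilon2)
    show "GH_distance A dA B dB \<le> ereal (c / 2) + ereal e" if "0 < e" for e
      using le[of "c / 2 + e"] that by simp
  qed
  then have "2 * GH_distance A dA B dB \<le> 2 * ereal (c / 2)"
    by (intro ereal_mult_left_mono) auto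
  then show ?thesis by simp
qed

lemma GH_distance_ge:
  assumes "\<And>R c. correspondence A B R \<Longrightarrow> distortion_le dA dB R c \<Longrightarrow> b \<le> c"
  shows "ereal b \<le> 2 * GH_distance A dA B dB"
proof -
  have "ereal (b / 2) \<le> GH_distance A dA B dB"
    unfolding GH_distance_def
  proof (rule Inf_greatest)
    fix x assume "x \<in> ereal ` {r. \<exists>(Z :: ('a + 'b) set) d. GH_realization A dA B dB r Z d}"
    then obtain r and Z :: "('a + 'b) set" and d
      where x: "x = ereal r" and G: "GH_realization A dA B dB r Z d" by blast
    have "b / 2 \<le> r"
    proof (rule dense_ge)
      fix s assume "r < s"
      from GH_realization_imp_correspondence[OF G this] show "b / 2 \<le> s" using assms by fastforce
    qed
    then show "ereal (b / 2) \<le> x" by (simp add: x)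
  qed
  then have "2 * ereal (b / 2) \<le> 2 * GH_distance A dA B dB"
    by (intro ereal_mult_left_mono) auto
  then show ?thesis by simp
qed

lemma GH_distance_eqI:
  assumes "Metric_space A dA" "Metric_space B dB" "A \<noteq> {}"
    and "correspondence A B R" "distortion_le dA dB R b"
    and "\<And>R c. correspondence A B R \<Longrightarrow> distortion_le dA dB R c \<Longrightarrow> b \<le> c"
  shows "2 * GH_distance A dA B dB = ereal b"
  using GH_distance_le[OF assms(1-5)] GH_distance_ge[of A B dA dB b] assms(6)
  by (metis antisym)

section \<open>Distances to simplexes\<close>

lemma spectrum_head_is_diameter:
  assumes U: "ultrametric_space X d" and fin: "finite X" and c: "2 \<le> card X"
  shows "x \<in> X \<Longrightarrow> y \<in> X \<Longrightarrow> d x y \<le> mst_sigma X d 1"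
    and "\<exists>x\<in>X. \<exists>y\<in>X. mst_sigma X d 1 \<le> d x y"
proof -
  obtain f :: "'a \<Rightarrow> nat" where f: "f ` X = {..<1}"
    "\<And>x y. x \<in> X \<Longrightarrow> y \<in> X \<Longrightarrow> f x = f y \<Longrightarrow> 1 < card X \<Longrightarrow> d x y \<le> mst_sigma X d 1"
  proof -
    have "1 \<le> card X" using c by simp
    from spectral_partition[OF U fin order_refl this] that show thesis by metis
  qed
  show "d x y \<le> mst_sigma X d 1" if "x \<in> X" "y \<in> X"
  proof -
    have "f x \<in> {..<1}" "f y \<in> {..<1}" using that f(1) by blast+
    then show ?thesis using f(2)[OF that] c by simp
  qed
  obtain g :: "'a \<Rightarrow> nat" where g: "g ` X = {..<2}"
    "\<And>x y. x \<in> X \<Longrightarrow> y \<in> X \<Longrightarrow> g x \<noteq> g y \<Longrightarrow> mst_sigma X d (2 - 1) \<le> d x y"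
  proof -
    have "1 \<le> (2::nat)" by simp
    from spectral_partition[OF U fin this c] that show thesis by metis
  qed
  have "0 \<in> g ` X" "1 \<in> g ` X" using g(1) by auto
  then obtain x y where "x \<in> X" "y \<in> X" "g x = 0" "g y = 1" by auto
  then show "\<exists>x\<in>X. \<exists>y\<in>X. mst_sigma X d 1 \<le> d x y" using g(2)[of x y] by auto
qed

lemma not_inj_on_card_less:
  assumes "finite B" "f ` A \<subseteq> B" "card B < card A"
  obtains x y where "x \<in> A" "y \<in> A" "x \<noteq> y" "f x = f y"
  using pigeonhole[of f A] card_mono[OF assms(1,2)] assms(3) unfolding inj_on_def by fastforce

context
  fixes S :: "'b set" and dS :: "'b \<Rightarrow> 'b \<Rightarrow> real" and X :: "'a set" and d :: "'a \<Rightarrow> 'a \<Rightarrow> real"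
    and lam :: real
  assumes S: "Metric_space S dS" "\<And>s t. s \<in> S \<Longrightarrow> t \<in> S \<Longrightarrow> s \<noteq> t \<Longrightarrow> dS s t = lam" "S \<noteq> {}"
    and lam: "0 < lam"
    and U: "ultrametric_space X d" and fin: "finite X" and two: "2 \<le> card X"
begin

interpretation S: Metric_space S dS by (rule S(1))

interpretation X: Metric_space X d using U by (simp add: ultrametric_space_def)

lemma distortion_ge_diameter_gap:
  assumes R: "correspondence S X R" and D: "distortion_le dS d R c"
  shows "mst_sigma X d 1 - lam \<le> c"
proof -
  obtain x y where xy: "x \<in> X" "y \<in> X" "mst_sigma X d 1 \<le> d x y"
    using spectrum_head_is_diameter(2)[OF U fin two] by blast
  obtain s t where st: "(s, x) \<in> R" "(t, y) \<in> R" using correspondenceD(4)[OF R] xy by meson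
  have "dS s t \<le> lam"
    using S(2)[of s t] correspondenceD(1)[OF R] st lam by (cases "s = t") auto
  then show ?thesis using distortion_leD[OF D st] xy(3) by linarith
qed

text \<open>One point from each of \<open>k + 1\<close> blocks of the spectral partition: two of these points share a
  vertex of the simplex.\<close>

lemma distortion_ge_sigma:
  assumes R: "correspondence S X R" and D: "distortion_le dS d R c"
    and k: "finite S" "card S = k" "k < card X"
  shows "mst_sigma X d k \<le> c"
proof -
  obtain f :: "'a \<Rightarrow> nat" where f: "f ` X = {..<Suc k}"
    "\<And>x y. x \<in> X \<Longrightarrow> y \<in> X \<Longrightarrow> f x \<noteq> f y \<Longrightarrow> mst_sigma X d (Suc k - 1) \<le> d x y"
  proof -
    have "1 \<le> Suc k" "Suc k \<le> card X" using k by auto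
    from spectral_partition[OF U fin this] that show thesis by metis
  qed
  have "\<forall>i\<in>{..<Suc k}. \<exists>x s. x \<in> X \<and> f x = i \<and> (s, x) \<in> R"
    using f(1) correspondenceD(4)[OF R] by (metis imageE)
  then obtain p q where pq: "\<And>i. i \<in> {..<Suc k} \<Longrightarrow> p i \<in> X \<and> f (p i) = i \<and> (q i, p i) \<in> R"
    by metis
  have "q ` {..<Suc k} \<subseteq> S" using pq correspondenceD(1)[OF R] by blast
  then obtain i j where ij: "i \<in> {..<Suc k}" "j \<in> {..<Suc k}" "i \<noteq> j" "q i = q j"
    by (rule not_inj_on_card_less[OF k(1)]) (use k in auto)
  have "mst_sigma X d k \<le> d (p i) (p j)" using f(2)[of "p i" "p j"] pq[OF ij(1)] pq[OF ij(2)] ij(3) by simp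
  moreover have "dS (q i) (q j) = 0"
    using ij(4) pq[OF ij(2)] correspondenceD(1)[OF R] S.zero by metis
  moreover have "\<bar>dS (q i) (q j) - d (p i) (p j)\<bar> \<le> c"
    using distortion_leD[OF D] pq ij by blast
  ultimately show ?thesis by linarith
qed

text \<open>A choice of a point for each of the \<open>k\<close> vertices sends two vertices into one of the \<open>k - 1\<close>
  blocks of the spectral partition.\<close>

lemma distortion_ge_simplex_gap:
  assumes R: "correspondence S X R" and D: "distortion_le dS d R c"
    and k: "finite S" "card S = k" "2 \<le> k" "k \<le> card X"
  shows "lam - mst_sigma X d (k - 1) \<le> c"
proof -
  obtain f :: "'a \<Rightarrow> nat" where f: "f ` X = {..<k - 1}"
    "\<And>x y. x \<in> X \<Longrightarrow> y \<in> X \<Longrightarrow> f x = f y \<Longrightarrow> d x y \<le> mst_sigma X d (k - 1)"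
  proof -
    have k': "1 \<le> k - 1" "k - 1 \<le> card X" "k - 1 < card X" using k by auto
    from spectral_partition[OF U fin k'(1,2)] k'(3) that show thesis by metis
  qed
  obtain h where h: "\<And>s. s \<in> S \<Longrightarrow> (s, h s) \<in> R" using correspondenceD(3)[OF R] by metis
  have hX: "h s \<in> X" if "s \<in> S" for s using h[OF that] correspondenceD(2)[OF R] by blast
  have "(\<lambda>s. f (h s)) ` S \<subseteq> {..<k - 1}" using hX f(1) by blast
  then obtain s t where st: "s \<in> S" "t \<in> S" "s \<noteq> t" "f (h s) = f (h t)"
    by (rule not_inj_on_card_less[OF finite_lessThan]) (use k in auto)
  have "d (h s) (h t) \<le> mst_sigma X d (k - 1)" using f(2) hX st by blast
  moreover have "\<bar>dS s t - d (h s) (h t)\<bar> \<le> c" using distortion_leD[OF D] h st by blast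
  ultimately show ?thesis using S(2)[OF st(1-3)] by linarith
qed

text \<open>Without an injection into \<open>X\<close>, two vertices of the simplex must share a point. This covers
  infinite simplexes as well.\<close>

lemma distortion_ge_side:
  assumes R: "correspondence S X R" and D: "distortion_le dS d R c"
    and big: "\<nexists>h. inj_on h S \<and> h ` S \<subseteq> X"
  shows "lam \<le> c"
proof -
  obtain h where h: "\<And>s. s \<in> S \<Longrightarrow> (s, h s) \<in> R" using correspondenceD(3)[OF R] by metis
  have hX: "h ` S \<subseteq> X" using h correspondenceD(2)[OF R] by blast
  then obtain s t where st: "s \<in> S" "t \<in> S" "s \<noteq> t" "h s = h t"
    using big unfolding inj_on_def by blast
  have "\<bar>dS s t - d (h s) (h t)\<bar> \<le> c" using distortion_leD[OF D] h st by blast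
  moreover have "d (h s) (h t) = 0" using st hX by auto
  ultimately show ?thesis using S(2)[OF st(1-3)] by linarith
qed

text \<open>Vertices are matched with the blocks of the spectral partition. The bound \<open>c\<close> enters through
  premises that apply only where the spectrum has the entries in question, so that the cases
  \<open>k = 1\<close>, \<open>1 < k < n\<close> and \<open>k = n\<close> are treated at once.\<close>

lemma small_simplex_correspondence:
  assumes k: "finite S" "card S = k" "k \<le> card X"
    and c1: "k < card X \<Longrightarrow> mst_sigma X d k \<le> c"
    and c2: "2 \<le> k \<Longrightarrow> mst_sigma X d 1 - lam \<le> c \<and> lam - mst_sigma X d (k - 1) \<le> c"
  shows "\<exists>R. correspondence S X R \<and> distortion_le dS d R c"
proof -
  have k1: "1 \<le> k" using k S(3) by (metis card_gt_0_iff less_eq_Suc_le One_nat_def)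
  obtain f :: "'a \<Rightarrow> nat" where f: "f ` X = {..<k}"
    "\<And>x y. x \<in> X \<Longrightarrow> y \<in> X \<Longrightarrow> f x = f y \<Longrightarrow> k < card X \<Longrightarrow> d x y \<le> mst_sigma X d k"
    "\<And>x y. x \<in> X \<Longrightarrow> y \<in> X \<Longrightarrow> f x = f y \<Longrightarrow> k = card X \<Longrightarrow> x = y"
    "\<And>x y. x \<in> X \<Longrightarrow> y \<in> X \<Longrightarrow> f x \<noteq> f y \<Longrightarrow> 1 < k \<and> mst_sigma X d (k - 1) \<le> d x y"
    using spectral_partition[OF U fin k1 k(3)] by blast
  obtain b where b: "bij_betw b S {..<k}"
    using finite_same_card_bij[OF k(1), of "{..<k}"] k(2) by auto
  define R where "R = {(s, x). s \<in> S \<and> x \<in> X \<and> b s = f x}"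
  have bS: "b ` S = {..<k}" and inj: "inj_on b S" using b by (simp_all add: bij_betw_def)
  have "\<exists>x. (s, x) \<in> R" if "s \<in> S" for s
  proof -
    have "b s \<in> f ` X" using that bS f(1) by blast
    then show ?thesis using that unfolding R_def by auto
  qed
  moreover have "\<exists>s. (s, x) \<in> R" if "x \<in> X" for x
  proof -
    have "f x \<in> b ` S" using that bS f(1) by blast
    then show ?thesis using that unfolding R_def by auto
  qed
  moreover have "R \<subseteq> S \<times> X" by (auto simp: R_def)
  ultimately have "correspondence S X R" unfolding correspondence_def by force
  moreover have "distortion_le dS d R c"
    unfolding distortion_le_def
  proof clarify
    fix s x t y assume "(s, x) \<in> R" "(t, y) \<in> R"
    then have m: "s \<in> S" "t \<in> S" "x \<in> X" "y \<in> X" "b s = f x" "b t = f y" by (auto simp: R_def)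
    show "\<bar>dS s t - d x y\<bar> \<le> c"
    proof (cases "s = t")
      case True
      then have fxy: "f x = f y" using m by simp
      have "d x y \<le> c"
      proof (cases "k < card X")
        case True
        then show ?thesis using f(2)[OF m(3,4) fxy] c1 by simp
      next
        case False
        then have "k = card X" using k(3) by simp
        then have "d x y = 0" using f(3)[OF m(3,4) fxy] m by simp
        \<comment> \<open>\<open>2 * c\<close> bounds the sum \<open>\<sigma>\<^sub>1 - \<sigma>\<^sub>k\<^sub>-\<^sub>1\<close> of the two differences, which is not negative\<close>
        moreover have "0 \<le> c"
        proof -
          have "2 \<le> k" using two \<open>k = card X\<close> by simp
          have "0 \<in> f ` X" "1 \<in> f ` X" using f(1) \<open>2 \<le> k\<close> by auto
          then obtain p q where "p \<in> X" "q \<in> X" "f p = 0" "f q = 1" by auto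
          then have "mst_sigma X d (k - 1) \<le> mst_sigma X d 1"
            using f(4)[of p q] spectrum_head_is_diameter(1)[OF U fin two, of p q] by simp
          then show ?thesis using c2[OF \<open>2 \<le> k\<close>] by linarith
        qed
        ultimately show ?thesis by simp
      qed
      then show ?thesis using True m by simp
    next
      case False
      then have "f x \<noteq> f y" using inj m by (metis inj_on_eq_iff)
      then have "1 < k \<and> mst_sigma X d (k - 1) \<le> d x y" using f(4) m by blast
      moreover have "d x y \<le> mst_sigma X d 1"
        using spectrum_head_is_diameter(1)[OF U fin two] m by blast
      ultimately show ?thesis using c2 S(2)[OF m(1,2) False] by auto
    qed
  qed
  ultimately show ?thesis by blast
qed

lemma big_simplex_correspondence:
  assumes g: "g ` S = X"
  shows "\<exists>R. correspondence S X R \<and> distortion_le dS d R (max (mst_sigma X d 1 - lam) lam)"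
proof (intro exI conjI)
  let ?R = "(\<lambda>s. (s, g s)) ` S"
  show "correspondence S X ?R" using g unfolding correspondence_def by (auto simp: image_image)
  show "distortion_le dS d ?R (max (mst_sigma X d 1 - lam) lam)"
    unfolding distortion_le_def
  proof clarify
    fix s t assume st: "s \<in> S" "t \<in> S"
    then have "d (g s) (g t) \<le> mst_sigma X d 1"
      using spectrum_head_is_diameter(1)[OF U fin two] g by blast
    moreover have "dS s t = lam \<or> dS s t = 0 \<and> d (g s) (g t) = 0"
      using S(2) S.zero X.zero st g by blast
    ultimately show "\<bar>dS s t - d (g s) (g t)\<bar> \<le> max (mst_sigma X d 1 - lam) lam"
      using X.nonneg[of "g s" "g t"] lam by linarith
  qed
qed

lemma GH_distance_point:
  assumes "finite S" "card S = 1"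
  shows "2 * GH_distance S dS X d = ereal (mst_sigma X d 1)"
proof -
  obtain R where "correspondence S X R" "distortion_le dS d R (mst_sigma X d 1)"
    using small_simplex_correspondence[OF assms] two by auto
  from GH_distance_eqI[OF S(1) X.Metric_space_axioms S(3) this] show ?thesis
    using distortion_ge_sigma assms two by auto
qed

lemma GH_distance_small_simplex:
  assumes k: "finite S" "card S = k" "1 < k" "k < card X"
  shows "2 * GH_distance S dS X d =
    ereal (Max {mst_sigma X d 1 - lam, mst_sigma X d k, lam - mst_sigma X d (k - 1)})"
proof -
  let ?c = "Max {mst_sigma X d 1 - lam, mst_sigma X d k, lam - mst_sigma X d (k - 1)}"
  have "\<exists>R. correspondence S X R \<and> distortion_le dS d R ?c"
    by (rule small_simplex_correspondence[OF k(1,2)]) (use k in auto)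
  then obtain R where "correspondence S X R" "distortion_le dS d R ?c" by blast
  from GH_distance_eqI[OF S(1) X.Metric_space_axioms S(3) this] show ?thesis
    using distortion_ge_sigma distortion_ge_simplex_gap distortion_ge_diameter_gap k by simp
qed

lemma GH_distance_equal_simplex:
  assumes k: "finite S" "card S = card X"
  shows "2 * GH_distance S dS X d =
    ereal (max (mst_sigma X d 1 - lam) (lam - mst_sigma X d (card X - 1)))"
proof -
  let ?c = "max (mst_sigma X d 1 - lam) (lam - mst_sigma X d (card X - 1))"
  have "\<exists>R. correspondence S X R \<and> distortion_le dS d R ?c"
    by (rule small_simplex_correspondence[OF k]) auto
  then obtain R where "correspondence S X R" "distortion_le dS d R ?c" by blast
  from GH_distance_eqI[OF S(1) X.Metric_space_axioms S(3) this] show ?thesis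
    using distortion_ge_simplex_gap distortion_ge_diameter_gap k two by simp
qed

lemma GH_distance_big_simplex:
  assumes "|X| <o |S|"
  shows "2 * GH_distance S dS X d = ereal (max (mst_sigma X d 1 - lam) lam)"
proof -
  have "\<nexists>h. inj_on h S \<and> h ` S \<subseteq> X"
    using assms card_of_ordLeq[of S X] not_ordLess_ordLeq by blast
  note ge = distortion_ge_side[OF _ _ this]
  have "X \<noteq> {}" using two by auto
  then obtain g where "g ` S = X"
    using ordLess_imp_ordLeq[OF assms] card_of_ordLeq2[of X S] by blast
  then obtain R where "correspondence S X R" "distortion_le dS d R (max (mst_sigma X d 1 - lam) lam)"
    using big_simplex_correspondence by blast
  from GH_distance_eqI[OF S(1) X.Metric_space_axioms S(3) this] show ?thesis
    using ge distortion_ge_diameter_gap by simp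
qed

end

lemma card_of_ordIso_nat_card:
  assumes "|S| =o nat_card k"
  shows "finite S \<and> card S = k"
proof -
  obtain b where b: "bij_betw b S {..<k}"
    using assms unfolding nat_card_def card_of_ordIso[symmetric] by blast
  then show ?thesis using bij_betw_finite bij_betw_same_card by fastforce
qed

theorem theorem3p3:
  fixes X :: "'a set" and dX :: "'a \<Rightarrow> 'a \<Rightarrow> real" and n :: nat
    and S :: "'b set" and dS :: "'b \<Rightarrow> 'b \<Rightarrow> real" and m :: "'c rel" and lam :: real
  assumes "ultrametric_space X dX" and "finite X" and "card X = n" and "n \<ge> 2"
    and "Card_order m" and "nat_card 0 <o m" and "lam > 0"
    and "is_simplex lam m S dS"
  shows "(m =o nat_card 1 \<longrightarrow>
            2 * GH_distance S dS X dX = ereal (mst_sigma X dX 1)) \<and>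
         (\<forall>k. 1 < k \<and> k < n \<and> m =o nat_card k \<longrightarrow>
            2 * GH_distance S dS X dX =
              ereal (Max {mst_sigma X dX 1 - lam, mst_sigma X dX k, lam - mst_sigma X dX (k - 1)})) \<and>
         (m =o nat_card n \<longrightarrow>
            2 * GH_distance S dS X dX =
              ereal (max (mst_sigma X dX 1 - lam) (lam - mst_sigma X dX (n - 1)))) \<and>
         (nat_card n <o m \<longrightarrow>
            2 * GH_distance S dS X dX = ereal (max (mst_sigma X dX 1 - lam) lam))"
proof -
  from assms(8) have MS: "Metric_space S dS" and Sm: "|S| =o m"
    and Sd: "\<And>s t. s \<in> S \<Longrightarrow> t \<in> S \<Longrightarrow> dS s t \<noteq> 0 \<Longrightarrow> dS s t = lam"
    by (auto simp: is_simplex_def)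
  have d: "dS s t = lam" if "s \<in> S" "t \<in> S" "s \<noteq> t" for s t
    using Sd[OF that(1,2)] Metric_space.zero[OF MS that(1,2)] that(3) by blast
  have ne: "S \<noteq> {}"
  proof
    assume "S = {}"
    then have "bij_betw (\<lambda>_. 0) S {..<0 :: nat}" by (simp add: bij_betw_def)
    then have "m =o nat_card 0"
      unfolding nat_card_def by (rule ordIso_transitive[OF ordIso_symmetric[OF Sm] card_of_ordIsoI])
    then show False using assms(6) not_ordLess_ordIso ordIso_symmetric by blast
  qed
  have c2: "2 \<le> card X" using assms(3,4) by simp
  note ctx = MS d ne assms(7,1,2) c2
  have fc: "finite S \<and> card S = k" if "m =o nat_card k" for k
    using card_of_ordIso_nat_card ordIso_transitive[OF Sm that] by blast
  have big: "|X| <o |S|" if "nat_card n <o m"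
  proof -
    obtain b where "bij_betw b X {..<n}"
      using finite_same_card_bij[OF assms(2), of "{..<n}"] assms(3) by auto
    then have "|X| =o nat_card n" unfolding nat_card_def by (rule card_of_ordIsoI)
    then show ?thesis using that ordIso_symmetric[OF Sm]
      by (meson ordIso_ordLess_trans ordLess_ordIso_trans)
  qed
  show ?thesis
    using GH_distance_point[OF ctx] GH_distance_small_simplex[OF ctx]
      GH_distance_equal_simplex[OF ctx] GH_distance_big_simplex[OF ctx] fc big assms(3) by auto
qed

end
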